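(* Let $m\ge 3$, let $G(m)$ be a dihedral Artin group, and let $X=\{x,y\}$ be the free product generating set. Then the permutation conjugacy length function $\mathrm{PCL}_{G(m),X}$ is constant.
   Context: For $m\ge 3$, $G(m)=\langle a,b \mid {}_m(a,b)={}_m(b,a)\rangle$, where ${}_m(a,b)$ is the alternating word $abab\cdots$ of length $m$. Free product generating set $X=\{x,y\}$ (closed under inverses, so words in $X^*$ are over $\{x^{\pm1},y^{\pm1}\}$): for $m$ odd, $x={}_m(a,b)$, $y=ab$, giving $G(m)\cong\langle x,y\mid x^2=y^m\rangle$; for $m=2p$ even, $x=ab$, $y=a$, giving $G(m)\cong\langle x,y\mid y^{-1}x^py=x^p\rangle=\mathrm{BS}(p,p)$. Let $G=\langle X\rangle$. If $u,v\in X^*$ represent conjugate elements of $G$, an element $w\in G$ is a PC-conjugator for $u$ and $v$ if there exist cyclic permutations $u'$ of $u$ and $v'$ of $v$ (as words) such that $wu'=_Gv'w$. Put $\mathrm{PCL}_{G,X}(u,v)=\min\{l(w)\mid w \text{ is a PC-conjugator for } u \text{ and } v\}$, where $l(w)$ is the word length of $w$. The permutation conjugacy length function is $\mathrm{PCL}_{G,X}(n)=\max\{\mathrm{PCL}_{G,X}(u,v)\mid u,v \text{ geodesic words representing conjugate elements, with } l(u)+l(v)\le n\}$. *)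

theory Defs
  imports "HOL-Algebra.Group"
begin

section \<open>Groups given by generators and relations\<close>

text \<open>The letter \<open>(s, True)\<close> stands for the generator \<open>s\<close>, and \<open>(s, False)\<close> for its
  formal inverse.\<close>

type_synonym 's gword = "('s \<times> bool) list"

text \<open>The congruence on words generated by free cancellation and by the relators
  \<open>r = s\<close> for \<open>(r, s) \<in> R\<close>.\<close>

inductive pres_eq :: "('s gword \<times> 's gword) set \<Rightarrow> 's gword \<Rightarrow> 's gword \<Rightarrow> bool"
  for R where
  refl: "pres_eq R u u"
| sym: "pres_eq R u v \<Longrightarrow> pres_eq R v u"
| trans: "pres_eq R u v \<Longrightarrow> pres_eq R v w \<Longrightarrow> pres_eq R u w"
| cancel: "pres_eq R (p @ [(s, e), (s, \<not> e)] @ q) (p @ q)"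
| relator: "(r, s) \<in> R \<Longrightarrow> pres_eq R (p @ r @ q) (p @ s @ q)"

definition pres_class :: "('s gword \<times> 's gword) set \<Rightarrow> 's gword \<Rightarrow> 's gword set" where
  "pres_class R u = {v. pres_eq R u v}"

definition presented_group :: "('s gword \<times> 's gword) set \<Rightarrow> 's gword set monoid" where
  "presented_group R =
     \<lparr> carrier = range (pres_class R),
       mult = (\<lambda>A B. {w. \<exists>u\<in>A. \<exists>v\<in>B. pres_eq R (u @ v) w}),
       one = pres_class R [] \<rparr>"

lemma pres_eq_append:
  assumes "pres_eq R u u'" "pres_eq R v v'"
  shows "pres_eq R (u @ v) (u' @ v')"
proof -
  have ctx: "pres_eq R (p @ a @ q) (p @ b @ q)" if "pres_eq R a b" for a b p q
    using that
  proof (induction)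
    case (cancel p' s e q')
    show ?case using pres_eq.cancel[of R "p @ p'" s e "q' @ q"] by simp
  next
    case (relator r s p' q')
    show ?case using pres_eq.relator[OF relator, of "p @ p'" "q' @ q"] by simp
  qed (blast intro: pres_eq.intros)+
  from ctx[OF assms(1), of "[]" v] ctx[OF assms(2), of u' "[]"]
  show ?thesis by (auto intro: pres_eq.trans)
qed

lemma pres_class_eq_iff: "pres_class R u = pres_class R v \<longleftrightarrow> pres_eq R u v"
  by (auto simp: pres_class_def intro: pres_eq.refl pres_eq.sym pres_eq.trans)

lemma presented_group_mult:
  "pres_class R u \<otimes>\<^bsub>presented_group R\<^esub> pres_class R v = pres_class R (u @ v)"
  by (auto simp: presented_group_def pres_class_def
      intro: pres_eq.refl pres_eq.sym pres_eq.trans pres_eq_append)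

lemma pres_eq_inverse: "pres_eq R (map (\<lambda>(s, e). (s, \<not> e)) (rev u) @ u) []"
proof (induction u)
  case (Cons l u)
  obtain s e where l: "l = (s, e)" by (cases l)
  show ?case
    using pres_eq.cancel[of R "map (\<lambda>(s, e). (s, \<not> e)) (rev u)" s "\<not> e" u] Cons
    by (auto simp: l intro: pres_eq.trans)
qed (auto intro: pres_eq.refl)

lemma group_presented_group: "group (presented_group R)"
proof (rule groupI)
  fix A assume "A \<in> carrier (presented_group R)"
  then obtain u where A: "A = pres_class R u" by (auto simp: presented_group_def)
  have "pres_class R (map (\<lambda>(s, e). (s, \<not> e)) (rev u)) \<otimes>\<^bsub>presented_group R\<^esub> A
          = \<one>\<^bsub>presented_group R\<^esub>"
    by (simp add: A presented_group_mult pres_class_eq_iff pres_eq_inverse)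
       (simp add: presented_group_def pres_class_eq_iff pres_eq_inverse)
  then show "\<exists>B\<in>carrier (presented_group R). B \<otimes>\<^bsub>presented_group R\<^esub> A = \<one>\<^bsub>presented_group R\<^esub>"
    by (auto simp: presented_group_def)
next
  have carr: "carrier (presented_group R) = range (pres_class R)"
    and one: "\<one>\<^bsub>presented_group R\<^esub> = pres_class R []"
    by (simp_all add: presented_group_def)
  show "\<one>\<^bsub>presented_group R\<^esub> \<in> carrier (presented_group R)"
    by (simp add: carr one)
  show "A \<otimes>\<^bsub>presented_group R\<^esub> B \<in> carrier (presented_group R)"
    if "A \<in> carrier (presented_group R)" "B \<in> carrier (presented_group R)" for A B
    using that by (auto simp: carr presented_group_mult)
  show "A \<otimes>\<^bsub>presented_group R\<^esub> B \<otimes>\<^bsub>presented_group R\<^esub> C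
          = A \<otimes>\<^bsub>presented_group R\<^esub> (B \<otimes>\<^bsub>presented_group R\<^esub> C)"
    if "A \<in> carrier (presented_group R)" "B \<in> carrier (presented_group R)"
      "C \<in> carrier (presented_group R)" for A B C
    using that by (auto simp: carr presented_group_mult)
  show "\<one>\<^bsub>presented_group R\<^esub> \<otimes>\<^bsub>presented_group R\<^esub> A = A"
    if "A \<in> carrier (presented_group R)" for A
    using that by (auto simp: carr one presented_group_mult)
qed


section \<open>Words over a generating set and the permutation conjugacy length function\<close>

text \<open>Words over a generating set \<open>X\<close> are lists of elements of the symmetric closure of
  \<open>X\<close>; two words are equal when they are equal as lists.\<close>

definition words_over :: "('g, 'r) monoid_scheme \<Rightarrow> 'g set \<Rightarrow> 'g list set" where
  "words_over G X = lists (X \<union> m_inv G ` X)"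

definition word_eval :: "('g, 'r) monoid_scheme \<Rightarrow> 'g list \<Rightarrow> 'g" where
  "word_eval G u = foldr (\<lambda>g h. g \<otimes>\<^bsub>G\<^esub> h) u \<one>\<^bsub>G\<^esub>"

definition word_length :: "('g, 'r) monoid_scheme \<Rightarrow> 'g set \<Rightarrow> 'g \<Rightarrow> nat" where
  "word_length G X g = (LEAST n. \<exists>u\<in>words_over G X. word_eval G u = g \<and> length u = n)"

definition geodesic :: "('g, 'r) monoid_scheme \<Rightarrow> 'g set \<Rightarrow> 'g list \<Rightarrow> bool" where
  "geodesic G X u \<longleftrightarrow>
     u \<in> words_over G X \<and> length u = word_length G X (word_eval G u)"

definition conjugate_in :: "('g, 'r) monoid_scheme \<Rightarrow> 'g \<Rightarrow> 'g \<Rightarrow> bool" where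
  "conjugate_in G g h \<longleftrightarrow> (\<exists>w\<in>carrier G. w \<otimes>\<^bsub>G\<^esub> g \<otimes>\<^bsub>G\<^esub> inv\<^bsub>G\<^esub> w = h)"

definition cyclic_permutation :: "'g list \<Rightarrow> 'g list \<Rightarrow> bool" where
  "cyclic_permutation u' u \<longleftrightarrow> (\<exists>k. u' = rotate k u)"

definition PC_conjugator :: "('g, 'r) monoid_scheme \<Rightarrow> 'g list \<Rightarrow> 'g list \<Rightarrow> 'g \<Rightarrow> bool" where
  "PC_conjugator G u v w \<longleftrightarrow> w \<in> carrier G \<and>
     (\<exists>u' v'. cyclic_permutation u' u \<and> cyclic_permutation v' v \<and>
        w \<otimes>\<^bsub>G\<^esub> word_eval G u' = word_eval G v' \<otimes>\<^bsub>G\<^esub> w)"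

definition PCL_pair :: "('g, 'r) monoid_scheme \<Rightarrow> 'g set \<Rightarrow> 'g list \<Rightarrow> 'g list \<Rightarrow> nat" where
  "PCL_pair G X u v = (LEAST k. \<exists>w. PC_conjugator G u v w \<and> word_length G X w = k)"

text \<open>For finite \<open>X\<close> the set below is finite, and it is nonempty because of the pair of empty
  words, so \<open>Max\<close> is the genuine maximum.\<close>

definition PCL :: "('g, 'r) monoid_scheme \<Rightarrow> 'g set \<Rightarrow> nat \<Rightarrow> nat" where
  "PCL G X n = Max {PCL_pair G X u v | u v.
     geodesic G X u \<and> geodesic G X v \<and>
     conjugate_in G (word_eval G u) (word_eval G v) \<and> length u + length v \<le> n}"


section \<open>Dihedral Artin groups\<close>

datatype artin_gen = gen_a | gen_b

primrec alt_word :: "nat \<Rightarrow> 's \<Rightarrow> 's \<Rightarrow> 's gword" where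
  "alt_word 0 s t = []"
| "alt_word (Suc n) s t = (s, True) # alt_word n t s"

definition artin_relators :: "nat \<Rightarrow> (artin_gen gword \<times> artin_gen gword) set" where
  "artin_relators m = {(alt_word m gen_a gen_b, alt_word m gen_b gen_a)}"

definition dihedral_artin :: "nat \<Rightarrow> artin_gen gword set monoid" where
  "dihedral_artin m = presented_group (artin_relators m)"

definition free_product_gen_x :: "nat \<Rightarrow> artin_gen gword set" where
  "free_product_gen_x m = pres_class (artin_relators m)
     (if odd m then alt_word m gen_a gen_b else [(gen_a, True), (gen_b, True)])"

definition free_product_gen_y :: "nat \<Rightarrow> artin_gen gword set" where
  "free_product_gen_y m = pres_class (artin_relators m)
     (if odd m then [(gen_a, True), (gen_b, True)] else [(gen_a, True)])"

definition free_product_gens :: "nat \<Rightarrow> artin_gen gword set set" where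
  "free_product_gens m = {free_product_gen_x m, free_product_gen_y m}"

end

theory Submission
  imports Defs "HOL-Algebra.Bij" "HOL-Algebra.Elementary_Groups"
begin

text \<open>The constant is \<open>0\<close>: any two words over \<open>X\<close> representing conjugate elements, geodesic or not,
  have cyclic permutations that are equal in \<open>G\<close>. The element \<open>z = x\<^sup>2 = y\<^sup>m\<close> (for odd \<open>m\<close>) or
  \<open>z = x\<^sup>p\<close> (for \<open>m = 2p\<close>) is central, and \<open>G\<close> modulo \<open>z\<close> is the free product of the cyclic groups
  generated by \<open>x\<close> and \<open>y\<close>. There every word has a cyclic permutation that evaluates to a
  cyclically reduced normal form, and conjugate cyclically reduced normal forms are cyclic
  permutations of each other. Hence some cyclic permutations of \<open>u\<close> and \<open>v\<close> agree up to a power of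
  \<open>z\<close>; that power is trivial because a homomorphism to the integers does not vanish on \<open>z\<close>.\<close>

section \<open>Rotations of words\<close>

lemma cyclic_permutation_iff_append:
  "cyclic_permutation u' u \<longleftrightarrow> (\<exists>p q. u = p @ q \<and> u' = q @ p)"
  unfolding cyclic_permutation_def
proof
  assume "\<exists>k. u' = rotate k u"
  then show "\<exists>p q. u = p @ q \<and> u' = q @ p"
    by (metis append_take_drop_id rotate_drop_take)
next
  assume "\<exists>p q. u = p @ q \<and> u' = q @ p"
  then show "\<exists>k. u' = rotate k u"
    by (metis rotate_append)
qed

lemma cyclic_permutation_refl [simp]: "cyclic_permutation u u"
  unfolding cyclic_permutation_def by (rule exI[of _ 0]) simp

lemma cyclic_permutation_append: "cyclic_permutation (q @ p) (p @ q)"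
  by (auto simp: cyclic_permutation_iff_append)

lemma cyclic_permutation_trans:
  "cyclic_permutation u v \<Longrightarrow> cyclic_permutation v w \<Longrightarrow> cyclic_permutation u w"
  unfolding cyclic_permutation_def using rotate_rotate by blast

lemma cyclic_permutation_map:
  "cyclic_permutation u v \<Longrightarrow> cyclic_permutation (map f u) (map f v)"
  unfolding cyclic_permutation_def by (metis rotate_map)

section \<open>Normal forms in a free product of cyclic groups\<close>

text \<open>A letter \<open>(i, k)\<close> stands for the \<open>k\<close>-th power of the generator of the \<open>i\<close>-th factor,
  which has order \<open>n i\<close>. Since \<open>k mod 0 = k\<close>, order \<open>0\<close> encodes an infinite cyclic factor.\<close>

locale cyclic_factors =
  fixes n :: "'i \<Rightarrow> int"
begin

definition reduced :: "('i \<times> int) list \<Rightarrow> bool" where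
  "reduced w \<longleftrightarrow> distinct_adj (map fst w) \<and> (\<forall>(i, k)\<in>set w. k mod n i = k \<and> k \<noteq> 0)"

text \<open>A one-letter word must be exempted: its first and last letter are the same letter, and
  nothing can be merged.\<close>

definition cyclically_reduced :: "('i \<times> int) list \<Rightarrow> bool" where
  "cyclically_reduced w \<longleftrightarrow>
     reduced w \<and> (length w \<le> 1 \<or> fst (hd w) \<noteq> fst (last w))"

text \<open>Intended for words \<open>w\<close> that do not begin with a letter of factor
  \<open>i\<close>, so that nothing has to be merged.\<close>

definition push :: "'i \<Rightarrow> int \<Rightarrow> ('i \<times> int) list \<Rightarrow> ('i \<times> int) list" where
  "push i k w = (if k mod n i = 0 then w else (i, k mod n i) # w)"

text \<open>Left multiplication by the \<open>k\<close>-th power of the \<open>i\<close>-th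
  generator on normal forms. One merge suffices: even if the first letter cancels, the next one
  belongs to another factor.\<close>

fun lmul :: "'i \<Rightarrow> int \<Rightarrow> ('i \<times> int) list \<Rightarrow> ('i \<times> int) list" where
  "lmul i k [] = push i k []"
| "lmul i k ((j, l) # w) = (if i = j then push i (k + l) w else push i k ((j, l) # w))"

text \<open>Arbitrary words act on normal forms, as in van der Waerden's proof of the normal form
  theorem for free products.\<close>

definition act :: "('i \<times> int) list \<Rightarrow> ('i \<times> int) list \<Rightarrow> ('i \<times> int) list" where
  "act u w = foldr (\<lambda>(i, k). lmul i k) u w"

definition nf :: "('i \<times> int) list \<Rightarrow> ('i \<times> int) list" where
  "nf u = act u []"

text \<open>Exponents are brought back to their residues so that inverses of reduced words are again
  reduced.\<close>

definition inverse_word :: "('i \<times> int) list \<Rightarrow> ('i \<times> int) list" where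
  "inverse_word u = map (\<lambda>(i, k). (i, - k mod n i)) (rev u)"

section \<open>The action of words on reduced words\<close>

lemma reduced_Nil [simp]: "reduced []"
  by (simp add: reduced_def)

lemma reduced_Cons:
  "reduced ((i, k) # w) \<longleftrightarrow>
     k mod n i = k \<and> k \<noteq> 0 \<and> reduced w \<and> (w = [] \<or> i \<noteq> fst (hd w))"
  by (cases w) (auto simp: reduced_def)

lemma reduced_append:
  "reduced (u @ v) \<longleftrightarrow>
     reduced u \<and> reduced v \<and> (u = [] \<or> v = [] \<or> fst (last u) \<noteq> fst (hd v))"
  by (auto simp: reduced_def distinct_adj_append_iff last_map hd_map)

lemma push_cong: "k mod n i = l mod n i \<Longrightarrow> push i k w = push i l w"
  by (simp add: push_def)

lemma lmul_cong: "k mod n i = l mod n i \<Longrightarrow> lmul i k w = lmul i l w"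
  by (cases "(i, k, w)" rule: lmul.cases) (auto intro!: push_cong mod_add_cong)

lemma lmul_mod [simp]: "lmul i (k mod n i) w = lmul i k w"
  by (rule lmul_cong) simp

lemma lmul_eq_push: "w = [] \<or> i \<noteq> fst (hd w) \<Longrightarrow> lmul i k w = push i k w"
  by (cases "(i, k, w)" rule: lmul.cases) auto

lemma reduced_push:
  "reduced w \<Longrightarrow> w = [] \<or> i \<noteq> fst (hd w) \<Longrightarrow> reduced (push i k w)"
  by (auto simp: push_def reduced_Cons)

lemma reduced_lmul: "reduced w \<Longrightarrow> reduced (lmul i k w)"
  by (cases "(i, k, w)" rule: lmul.cases) (auto simp: reduced_Cons intro!: reduced_push)

lemma lmul_push:
  "w = [] \<or> i \<noteq> fst (hd w) \<Longrightarrow> lmul i k (push i l w) = push i (k + l) w"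
  by (auto simp: push_def[of i l] lmul_eq_push intro!: push_cong)
     (metis add.right_neutral mod_add_right_eq, metis mod_add_right_eq)

text \<open>If \<open>w\<close> begins with a letter of factor \<open>i\<close>, reducedness keeps
  its tail from doing so; after the first merge \<open>lmul_push\<close> therefore applies to the
  tail.\<close>

lemma lmul_lmul: "reduced w \<Longrightarrow> lmul i k (lmul i l w) = lmul i (k + l) w"
proof (cases "w = [] \<or> i \<noteq> fst (hd w)")
  case True
  then show ?thesis by (simp add: lmul_eq_push[OF True] lmul_push)
next
  case False
  then obtain m w' where w: "w = (i, m) # w'" by (cases w) auto
  assume "reduced w"
  then show ?thesis by (auto simp: w reduced_Cons lmul_push add.assoc)
qed

lemma lmul_0: "reduced w \<Longrightarrow> lmul i 0 w = w"
  by (cases "(i, 0 :: int, w)" rule: lmul.cases) (auto simp: reduced_Cons push_def)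

lemma lmul_reduced_Cons: "reduced ((i, k) # w) \<Longrightarrow> lmul i k w = (i, k) # w"
  by (auto simp: reduced_Cons lmul_eq_push push_def)

lemma act_simps [simp]:
  "act [] w = w" "act ((i, k) # u) w = lmul i k (act u w)"
  "act (u @ v) w = act u (act v w)"
  by (simp_all add: act_def)

lemma reduced_act: "reduced w \<Longrightarrow> reduced (act u w)"
  by (induction u) (auto intro: reduced_lmul)

lemma reduced_nf [simp]: "reduced (nf u)"
  by (simp add: nf_def reduced_act)

lemma act_reduced: "reduced (u @ w) \<Longrightarrow> act u w = u @ w"
proof (induction u)
  case (Cons p u)
  then show ?case by (cases p) (auto simp: reduced_Cons intro!: lmul_reduced_Cons)
qed simp

lemma nf_reduced: "reduced u \<Longrightarrow> nf u = u"
  using act_reduced[of u "[]"] by (simp add: nf_def)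

text \<open>Two things can happen to the new letter: it merges with the head of \<open>v\<close>,
  which \<open>lmul_lmul\<close> accounts for, or its exponent vanishes modulo \<open>n i\<close>,
  and then \<open>lmul i k\<close> is the identity on reduced words.\<close>

lemma act_lmul:
  "reduced v \<Longrightarrow> reduced w \<Longrightarrow> act (lmul i k v) w = lmul i k (act v w)"
proof (cases "v = [] \<or> i \<noteq> fst (hd v)")
  case True
  assume "reduced w"
  then have "lmul i k (act v w) = act v w" if "k mod n i = 0"
    using that lmul_cong[of k i 0] by (simp add: lmul_0 reduced_act)
  then show ?thesis by (simp add: lmul_eq_push[OF True] push_def)
next
  case False
  then obtain l v' where v: "v = (i, l) # v'" by (cases v) auto
  assume "reduced w"
  have red: "reduced (act v' w)" using \<open>reduced w\<close> by (rule reduced_act)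
  have "act (push i (k + l) v') w = lmul i (k + l) (act v' w)"
    using lmul_0[OF red, of i] lmul_cong[of "k + l" i 0 "act v' w"]
    by (auto simp: push_def)
  then show ?thesis by (simp add: v lmul_lmul[OF red])
qed

lemma act_nf: "reduced w \<Longrightarrow> act (nf u) w = act u w"
proof (induction u)
  case (Cons p u)
  obtain i k where p: "p = (i, k)" by (cases p)
  have "nf (p # u) = lmul i k (nf u)" by (simp add: p nf_def)
  with Cons show ?case by (simp add: p act_lmul)
qed (simp add: nf_def)

section \<open>Inverses and rotations of reduced words\<close>

lemma inverse_word_simps [simp]:
  "inverse_word [] = []"
  "inverse_word (u @ [(i, k)]) = (i, - k mod n i) # inverse_word u"
  by (simp_all add: inverse_word_def)

lemma reduced_inverse_word: "reduced u \<Longrightarrow> reduced (inverse_word u)"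
proof -
  assume u: "reduced u"
  have "map fst (inverse_word u) = rev (map fst u)"
    by (simp add: inverse_word_def rev_map case_prod_unfold)
  moreover have "- k mod n i \<noteq> 0" if "k mod n i = k" "k \<noteq> 0" for i k
    using that by (auto simp: mod_eq_0_iff_dvd)
  ultimately show ?thesis
    using u by (auto simp: reduced_def) (auto simp: inverse_word_def)
qed

lemma hd_inverse_word: "u \<noteq> [] \<Longrightarrow> fst (hd (inverse_word u)) = fst (last u)"
  by (simp add: inverse_word_def hd_map hd_rev case_prod_unfold)

lemma last_inverse_word: "u \<noteq> [] \<Longrightarrow> fst (last (inverse_word u)) = fst (hd u)"
  by (simp add: inverse_word_def last_map last_rev case_prod_unfold)

lemma inverse_word_eq_Nil [simp]: "inverse_word u = [] \<longleftrightarrow> u = []"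
  by (simp add: inverse_word_def)

lemma cyclically_reduced_rotate:
  assumes "cyclically_reduced (p # u)" shows "cyclically_reduced (u @ [p])"
proof (cases "u = []")
  case False
  obtain i k where "p = (i, k)" by (cases p)
  with False assms show ?thesis
    by (auto simp: cyclically_reduced_def reduced_append reduced_Cons)
qed (use assms in simp)

lemma cyclically_reduced_cyclic_permutation:
  assumes "cyclically_reduced u" "cyclic_permutation v u"
  shows "cyclically_reduced v"
proof -
  have *: "cyclically_reduced (q @ p)" if "cyclically_reduced (p @ q)" for p q
    using that
  proof (induction p arbitrary: q)
    case (Cons a p)
    then show ?case using cyclically_reduced_rotate[of a "p @ q"] by force
  qed simp
  from assms show ?thesis by (auto simp: cyclic_permutation_iff_append intro: *)
qed

section \<open>Rotating a word until its normal form is cyclically reduced\<close>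

lemma act_normalised: "act (map (\<lambda>(i, k). (i, k mod n i)) u) w = act u w"
  by (induction u) auto

text \<open>The obstructions are a vanishing exponent, two neighbouring letters of one factor, and
  end letters of one factor. A rotation brings each to the front and makes the last two look
  alike.\<close>

lemma not_cyclically_reducedE:
  assumes "\<forall>(i, k)\<in>set u. k mod n i = k" "\<not> cyclically_reduced u"
  obtains i v where "cyclic_permutation ((i, 0) # v) u"
  | i k l v where "cyclic_permutation ((i, k) # (i, l) # v) u"
proof -
  consider i where "(i, 0) \<in> set u" | "\<not> distinct_adj (map fst u)"
    | "length u > 1" "fst (hd u) = fst (last u)"
    using assms by (fastforce simp: cyclically_reduced_def reduced_def)
  then show ?thesis
  proof cases
    case (1 i)
    then obtain p q where "u = p @ (i, 0) # q" by (meson split_list)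
    then have "cyclic_permutation ((i, 0) # (q @ p)) u"
      using cyclic_permutation_append[of "(i, 0) # q" p] by simp
    then show ?thesis by (rule that)
  next
    case 2
    then obtain j where j: "Suc j < length u" "fst (u ! j) = fst (u ! Suc j)"
      by (auto simp: distinct_adj_conv_nth)
    then have "u = take j u @ u ! j # u ! Suc j # drop (Suc (Suc j)) u"
      by (metis Cons_nth_drop_Suc Suc_lessD append_take_drop_id)
    then have "cyclic_permutation ((u ! j # u ! Suc j # drop (Suc (Suc j)) u) @ take j u) u"
      by (metis cyclic_permutation_append)
    with j show ?thesis using that(2)
      by (cases "u ! j"; cases "u ! Suc j") auto
  next
    \<comment> \<open>Length greater than 1 makes the first and the last letter different positions,
      so moving the last one to the front creates a mergeable pair.\<close>
    case 3
    then obtain a p b where u: "u = a # p @ [b]"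
      by (cases u; cases "tl u" rule: rev_cases) auto
    then have "cyclic_permutation (b # a # p) u"
      using cyclic_permutation_append[of "[b]" "a # p"] by simp
    with 3 show ?thesis using that(2) by (cases a; cases b) (auto simp: u)
  qed
qed

text \<open>A rotation never cuts through the single letter \<open>a\<close>. This matters when
  \<open>a\<close> arose by merging two letters: putting the pair back in its place gives a rotation
  of the longer word.\<close>

lemma cyclic_permutation_ConsE:
  assumes "cyclic_permutation v' (a # v)"
  obtains p q where "v' = q @ a # p" "v = p @ q"
  using assms that
  by (fastforce simp: cyclic_permutation_iff_append Cons_eq_append_conv)

text \<open>Cancelling or merging cyclically adjacent letters does not lose rotations: a rotation of
  the shorter word lifts to one of the longer word, because it is cut outside the merged pair.\<close>

lemma cyclic_reduction:
  "\<exists>c. cyclically_reduced c \<and>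
     (\<forall>c'. cyclic_permutation c' c \<longrightarrow> (\<exists>u'. cyclic_permutation u' u \<and> nf u' = c'))"
proof (induction "length u" arbitrary: u rule: less_induct)
  case less
  \<comment> \<open>Reducing exponents acts letter by letter, so it commutes with rotations, and it
    does not change normal forms.\<close>
  define N where "N = map (\<lambda>(i, k). (i, k mod n i))"
  have lift_N: "\<exists>u'. cyclic_permutation u' u \<and> nf u' = nf v'" if "cyclic_permutation v' (N u)" for v'
  proof -
    obtain k where "v' = rotate k (N u)"
      using \<open>cyclic_permutation v' (N u)\<close> by (auto simp: cyclic_permutation_def)
    then have "v' = N (rotate k u)" by (simp add: N_def rotate_map)
    then have "nf (rotate k u) = nf v'"
      by (simp add: nf_def N_def act_normalised)
    then show ?thesis by (auto simp: cyclic_permutation_def)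
  qed
  \<comment> \<open>It is enough to find a shorter word each of whose rotations has the normal form
    of some rotation of \<open>N u\<close>.\<close>
  have step: ?case if "length v < length u"
    and lift: "\<And>v'. cyclic_permutation v' v \<Longrightarrow> \<exists>u'. cyclic_permutation u' (N u) \<and> nf u' = nf v'" for v
  proof -
    from less[OF that(1)] obtain c where c: "cyclically_reduced c"
      "\<And>c'. cyclic_permutation c' c \<Longrightarrow> \<exists>v'. cyclic_permutation v' v \<and> nf v' = c'" by blast
    then show ?thesis using lift lift_N by (intro exI[of _ c]) metis
  qed
  show ?case
  proof (cases "cyclically_reduced (N u)")
    case True
    have "nf c' = c'" if "cyclic_permutation c' (N u)" for c'
      using cyclically_reduced_cyclic_permutation[OF True that]
      by (intro nf_reduced) (simp add: cyclically_reduced_def)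
    with True lift_N show ?thesis by (intro exI[of _ "N u"]) metis
  next
    case False
    have "\<forall>(i, k)\<in>set (N u). k mod n i = k" by (auto simp: N_def)
    then show ?thesis using False
    proof (cases rule: not_cyclically_reducedE)
      case (1 i v)
      show ?thesis
      proof (rule step)
        show "length v < length u" using 1
          by (auto simp: N_def cyclic_permutation_def dest!: arg_cong[of _ _ length])
        fix v' assume "cyclic_permutation v' v"
        then obtain p q where pq: "v = p @ q" "v' = q @ p"
          by (auto simp: cyclic_permutation_iff_append)
        have "cyclic_permutation (q @ (i, 0) # p) (N u)"
          using 1 cyclic_permutation_append[of q "(i, 0) # p"]
          by (auto simp: pq intro: cyclic_permutation_trans)
        moreover have "nf (q @ (i, 0) # p) = nf v'"
          by (simp add: nf_def pq lmul_0 reduced_act)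
        ultimately show "\<exists>u'. cyclic_permutation u' (N u) \<and> nf u' = nf v'" by blast
      qed
    next
      case (2 i k l v)
      show ?thesis
      proof (rule step)
        show "length ((i, k + l) # v) < length u" using 2
          by (auto simp: N_def cyclic_permutation_def dest!: arg_cong[of _ _ length])
        fix v' assume "cyclic_permutation v' ((i, k + l) # v)"
        then obtain p q where pq: "v' = q @ (i, k + l) # p" "v = p @ q"
          by (rule cyclic_permutation_ConsE)
        have "cyclic_permutation (q @ (i, k) # (i, l) # p) (N u)"
          using 2 cyclic_permutation_append[of q "(i, k) # (i, l) # p"]
          by (auto simp: pq intro: cyclic_permutation_trans)
        moreover have "nf (q @ (i, k) # (i, l) # p) = nf v'"
          by (simp add: nf_def pq lmul_lmul reduced_act)
        ultimately show "\<exists>u'. cyclic_permutation u' (N u) \<and> nf u' = nf v'" by blast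
      qed
    qed
  qed
qed

section \<open>Conjugate cyclically reduced normal forms\<close>

lemma conjugate_not_cyclically_reduced:
  assumes "reduced (g @ v @ inverse_word g)" "v \<noteq> []" "g \<noteq> [] \<or> length v > 1 \<and> fst (hd v) = fst (last v)"
  shows "\<not> cyclically_reduced (nf (g @ v @ inverse_word g))"
proof (cases "g = []")
  \<comment> \<open>The outermost letters come from \<open>g\<close> and from its inverse, hence
    from the same factor.\<close>
  case False
  then have "length (inverse_word g) \<ge> 1" "length g \<ge> 1" by (simp_all add: Suc_le_eq)
  with False assms(1,2) show ?thesis
    by (auto simp: nf_reduced cyclically_reduced_def last_inverse_word)
qed (use assms in \<open>auto simp: nf_reduced cyclically_reduced_def\<close>)

text \<open>Peel off the last letter \<open>s\<close> of \<open>g\<close>, the one next to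
  \<open>c\<close>. Either conjugation by \<open>s\<close> merely rotates \<open>c\<close>, and the
  shorter \<open>g\<close> acts on the rotated word, or no further cancellation occurs and the
  conjugate visibly fails to be cyclically reduced.\<close>

lemma conjugate_cyclically_reduced:
  assumes "cyclically_reduced c" "reduced g" "cyclically_reduced (nf (g @ c @ inverse_word g))"
  shows "cyclic_permutation (nf (g @ c @ inverse_word g)) c"
  using assms
proof (induction g arbitrary: c rule: rev_induct)
  case Nil
  then show ?case by (simp add: nf_reduced cyclically_reduced_def)
next
  case (snoc s g)
  obtain i k where s: "s = (i, k)" by (cases s)
  have k: "k mod n i = k" "k \<noteq> 0" "- k mod n i \<noteq> 0"
    and g: "reduced g" "g \<noteq> [] \<Longrightarrow> fst (last g) \<noteq> i"
    using snoc.prems(2) by (auto simp: s reduced_append reduced_Cons mod_eq_0_iff_dvd)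
  have g': "reduced (inverse_word g)" "g \<noteq> [] \<Longrightarrow> fst (hd (inverse_word g)) \<noteq> i"
    using g by (auto simp: reduced_inverse_word hd_inverse_word)
  have c: "reduced c" using snoc.prems(1) by (simp add: cyclically_reduced_def)
  \<comment> \<open>The favourable outcome: conjugating \<open>c\<close> by \<open>s\<close> has the
    same effect as a rotation \<open>c'\<close> of \<open>c\<close>.\<close>
  have IH: "cyclic_permutation (nf ((g @ [s]) @ c @ inverse_word (g @ [s]))) c"
    if "cyclic_permutation c' c"
      "\<And>w. reduced w \<Longrightarrow> act [(i, k)] (act c (act [(i, - k)] w)) = act c' w" for c'
  proof -
    have eq: "nf ((g @ [s]) @ c @ inverse_word (g @ [s])) = nf (g @ c' @ inverse_word g)"
      using that(2)[OF reduced_nf] by (simp add: nf_def s)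
    have "cyclically_reduced c'"
      using snoc.prems(1) that(1) by (rule cyclically_reduced_cyclic_permutation)
    from snoc.IH[OF this g(1)] snoc.prems(3) that(1) show ?thesis
      unfolding eq by (blast intro: cyclic_permutation_trans)
  qed
  \<comment> \<open>The other outcome: the conjugate by \<open>s\<close> acts as a word
    \<open>v\<close> that stays reduced between \<open>g\<close> and its inverse.\<close>
  have contra: False
    if "reduced (g @ v @ inverse_word g)" "v \<noteq> []"
      "g \<noteq> [] \<or> length v > 1 \<and> fst (hd v) = fst (last v)"
      "\<And>w. reduced w \<Longrightarrow> act [(i, k)] (act c (act [(i, - k)] w)) = act v w" for v
  proof -
    have eq: "nf ((g @ [s]) @ c @ inverse_word (g @ [s])) = nf (g @ v @ inverse_word g)"
      using that(4)[OF reduced_nf] by (simp add: nf_def s)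
    show False using conjugate_not_cyclically_reduced[OF that(1-3)] snoc.prems(3) eq by simp
  qed
  \<comment> \<open>The cases record at which ends of \<open>c\<close> the letter \<open>s\<close>
    and its inverse can merge. Cyclic reducedness prevents a \<open>c\<close> of length at least 2
    from meeting factor \<open>i\<close> at both ends.\<close>
  consider "c = []" | l where "c = [(i, l)]"
    | l c' where "c = (i, l) # c'" "c' \<noteq> []"
    | l c' where "c = c' @ [(i, l)]" "c' \<noteq> []"
    | "c \<noteq> []" "fst (hd c) \<noteq> i" "fst (last c) \<noteq> i"
  proof (cases "c = []")
    case False
    obtain a c1 where a: "c = a # c1" using False by (cases c) auto
    obtain b c2 where b: "c = c2 @ [b]" using False by (cases c rule: rev_cases) auto
    have "hd c = a" using a by simp
    moreover have "last c = b" using b by simp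
    moreover have "a = (i, snd a)" if "fst a = i" using that by (simp add: prod_eq_iff)
    moreover have "b = (i, snd b)" if "fst b = i" using that by (simp add: prod_eq_iff)
    moreover have "a = b" if "c2 = []" using that a b by simp
    ultimately show ?thesis
      using that(2)[of "snd a"] that(3)[of "snd a" c1] that(4)[of c2 "snd b"] that(5) a b False
      by metis
  qed (rule that(1))
  then show ?case
  proof cases
    case 1
    show ?thesis by (rule IH[of c]) (simp_all add: 1 lmul_lmul lmul_0)
  next
    case (2 l)
    \<comment> \<open>All three letters lie in the commutative factor \<open>i\<close>, so
      conjugation changes nothing.\<close>
    show ?thesis by (rule IH[of c]) (simp_all add: 2 lmul_lmul reduced_lmul)
  next
    case (3 l c')
    have ends: "fst (last c') \<noteq> i" "fst (hd c') \<noteq> i" "reduced c'" "l mod n i = l"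
      using 3 snoc.prems(1) by (auto simp: cyclically_reduced_def reduced_Cons Suc_le_eq)
    show ?thesis
    proof (cases "(k + l) mod n i = 0")
      case True
      \<comment> \<open>The letter \<open>s\<close> cancels the head of \<open>c\<close>, and its
        inverse restores the same letter at the end: a rotation by one place.\<close>
      have "- k mod n i = l mod n i" using True dvd_minus_iff[of "n i" "k + l"]
        by (simp add: mod_eq_dvd_iff mod_eq_0_iff_dvd)
      then have eq: "lmul i (- k) w = lmul i l w" for w by (rule lmul_cong)
      have "lmul i k (lmul i l w) = w" if "reduced w" for w
        using lmul_cong[of "k + l" i 0 w] True that by (simp add: lmul_lmul lmul_0)
      with cyclic_permutation_append[of c' "[(i, l)]"] show ?thesis
        by - (rule IH[of "c' @ [(i, l)]"], simp_all add: 3 eq reduced_act reduced_lmul)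
    next
      case False
      have "reduced (g @ ((i, (k + l) mod n i) # c' @ [(i, - k mod n i)]) @ inverse_word g)"
        using False g g' k ends 3(2) by (auto simp: reduced_append reduced_Cons)
      then have False
        by (rule contra) (simp_all add: 3 lmul_lmul reduced_act reduced_lmul)
      then show ?thesis ..
    qed
  next
    case (4 l c')
    have ends: "fst (last c') \<noteq> i" "fst (hd c') \<noteq> i" "reduced c'" "l mod n i = l"
      using 4 snoc.prems(1) by (auto simp: cyclically_reduced_def reduced_append reduced_Cons Suc_le_eq)
    show ?thesis
    proof (cases "(l - k) mod n i = 0")
      case True
      \<comment> \<open>Mirror image: the last letter of \<open>c\<close> cancels and reappears at
        the front.\<close>
      have "k mod n i = l mod n i" using True
        by (subst eq_commute) (simp add: mod_eq_dvd_iff mod_eq_0_iff_dvd)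
      then have eq: "lmul i k w = lmul i l w" for w by (rule lmul_cong)
      have "lmul i l (lmul i (- k) w) = w" if "reduced w" for w
        using lmul_cong[of "l - k" i 0 w] True that by (simp add: lmul_lmul lmul_0)
      with cyclic_permutation_append[of "[(i, l)]" c'] show ?thesis
        by - (rule IH[of "(i, l) # c'"], simp_all add: 4 eq reduced_act reduced_lmul)
    next
      case False
      have "reduced (g @ ((i, k) # c' @ [(i, (l - k) mod n i)]) @ inverse_word g)"
        using False g g' k ends 4(2) by (auto simp: reduced_append reduced_Cons)
      then have False
        by (rule contra) (simp_all add: 4 lmul_lmul reduced_act reduced_lmul)
      then show ?thesis ..
    qed
  next
    case 5
    have "reduced (g @ ((i, k) # c @ [(i, - k mod n i)]) @ inverse_word g)"
      using g g' k 5 c by (auto simp: reduced_append reduced_Cons)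
    then have False
      by (rule contra) (simp_all add: lmul_lmul reduced_act reduced_lmul)
    then show ?thesis ..
  qed
qed

end

section \<open>Conjugacy in central extensions of free products of cyclic groups\<close>

lemma word_eval_Nil [simp]: "word_eval G [] = \<one>\<^bsub>G\<^esub>"
  and word_eval_Cons [simp]: "word_eval G (a # u) = a \<otimes>\<^bsub>G\<^esub> word_eval G u"
  by (simp_all add: word_eval_def)

lemma (in group) word_eval_closed [simp]: "set u \<subseteq> carrier G \<Longrightarrow> word_eval G u \<in> carrier G"
  by (induction u) auto

lemma (in group) word_eval_append [simp]:
  "set u \<subseteq> carrier G \<Longrightarrow> set v \<subseteq> carrier G \<Longrightarrow>
     word_eval G (u @ v) = word_eval G u \<otimes> word_eval G v"
  by (induction u) (auto simp: m_assoc)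

lemma (in group) inv_commute:
  assumes "a \<in> carrier G" "b \<in> carrier G" "a \<otimes> b = b \<otimes> a"
  shows "inv a \<otimes> b = b \<otimes> inv a"
proof -
  have "inv a \<otimes> b = inv a \<otimes> (b \<otimes> a) \<otimes> inv a" using assms(1,2) by (simp add: m_assoc)
  also have "\<dots> = inv a \<otimes> (a \<otimes> b) \<otimes> inv a" by (simp only: assms(3))
  also have "\<dots> = b \<otimes> inv a" using assms(1,2) by (simp flip: m_assoc)
  finally show ?thesis .
qed

lemma (in group) cyclic_permutation_conjugate:
  assumes "cyclic_permutation v u" "set u \<subseteq> carrier G"
  shows "conjugate_in G (word_eval G u) (word_eval G v)"
proof -
  obtain p q where pq: "u = p @ q" "v = q @ p"
    using assms(1) by (auto simp: cyclic_permutation_iff_append)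
  have closed: "word_eval G p \<in> carrier G" "word_eval G q \<in> carrier G"
    using assms(2) by (auto simp: pq)
  then have "word_eval G q \<otimes> (word_eval G p \<otimes> word_eval G q) \<otimes> inv (word_eval G q)
      = word_eval G q \<otimes> word_eval G p"
    by (simp add: m_assoc)
  then show ?thesis
    using closed assms(2) unfolding conjugate_in_def pq by (intro bexI[of _ "word_eval G q"]) auto
qed

lemma (in group) conjugate_in_sym:
  assumes "a \<in> carrier G" "conjugate_in G a b"
  shows "conjugate_in G b a"
proof -
  obtain w where w: "w \<in> carrier G" "w \<otimes> a \<otimes> inv w = b"
    using assms(2) by (auto simp: conjugate_in_def)
  then have "inv w \<otimes> b \<otimes> inv (inv w) = a"
    using assms(1) by (auto simp: m_assoc inv_solve_left' simp flip: w(2))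
  then show ?thesis using w(1) unfolding conjugate_in_def by blast
qed

lemma (in group) conjugate_in_trans:
  assumes "a \<in> carrier G" "conjugate_in G a b" "conjugate_in G b c"
  shows "conjugate_in G a c"
proof -
  obtain w where w: "w \<in> carrier G" "w \<otimes> a \<otimes> inv w = b"
    using assms(2) by (auto simp: conjugate_in_def)
  obtain w' where w': "w' \<in> carrier G" "w' \<otimes> b \<otimes> inv w' = c"
    using assms(3) by (auto simp: conjugate_in_def)
  have "(w' \<otimes> w) \<otimes> a \<otimes> inv (w' \<otimes> w) = c"
    using w(1) w'(1) assms(1) by (simp add: inv_mult_group m_assoc flip: w(2) w'(2))
  then show ?thesis using w(1) w'(1) unfolding conjugate_in_def by blast
qed

section \<open>The permutation representation on reduced words\<close>

lemma BijGroup_apply: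
  assumes "f \<in> carrier (BijGroup S)" "g \<in> carrier (BijGroup S)" "x \<in> S"
  shows "(f \<otimes>\<^bsub>BijGroup S\<^esub> g) x = f (g x)"
  using assms by (simp add: BijGroup_def compose_eq)

lemma BijGroup_eqI:
  assumes "f \<in> carrier (BijGroup S)" "g \<in> carrier (BijGroup S)" "\<And>x. x \<in> S \<Longrightarrow> f x = g x"
  shows "f = g"
  using assms by (auto simp: BijGroup_def Bij_def intro: extensionalityI)

context cyclic_factors
begin

abbreviation Words :: "('i \<times> int) list set" where
  "Words \<equiv> {w. reduced w}"

text \<open>The restriction is there because elements of \<open>BijGroup\<close> are extensional
  functions.\<close>

definition translation :: "'i \<Rightarrow> int \<Rightarrow> ('i \<times> int) list \<Rightarrow> ('i \<times> int) list" where
  "translation i k = restrict (lmul i k) Words"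

lemma translation_closed: "translation i k \<in> carrier (BijGroup Words)"
proof -
  have "bij_betw (lmul i k) Words Words"
    by (rule bij_betwI[where g = "lmul i (- k)"])
       (auto simp: lmul_lmul lmul_0 intro: reduced_lmul)
  then show ?thesis
    by (simp add: translation_def BijGroup_def Bij_def)
qed

lemma translation_hom: "translation i \<in> hom integer_group (BijGroup Words)"
proof (rule homI)
  fix k l
  have "translation i (k + l) = translation i k \<otimes>\<^bsub>BijGroup Words\<^esub> translation i l"
    using group_BijGroup[of Words]
    by (intro BijGroup_eqI[of _ Words])
       (simp_all add: translation_closed group.is_monoid monoid.m_closed BijGroup_apply,
        simp add: translation_def lmul_lmul reduced_lmul)
  then show "translation i (k \<otimes>\<^bsub>integer_group\<^esub> l)
      = translation i k \<otimes>\<^bsub>BijGroup Words\<^esub> translation i l"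
    by simp
qed (simp add: translation_closed)

lemma translation_pow: "translation i 1 [^]\<^bsub>BijGroup Words\<^esub> (k :: int) = translation i k"
  using hom_int_pow[OF translation_hom, of 1 i k] by (simp add: group_BijGroup)

lemma translation_order: "translation i (n i) = \<one>\<^bsub>BijGroup Words\<^esub>"
  using lmul_cong[of "n i" i 0]
  by (auto simp: translation_def BijGroup_def lmul_0 intro!: restrict_ext)

end

text \<open>Modulo the central element \<open>z\<close>, the \<open>i\<close>-th generator satisfies
  the order relation given by \<open>n i\<close>. The representation \<open>\<rho>\<close> makes
  normal forms invariants of group elements, and \<open>\<phi>\<close> detects the powers of
  \<open>z\<close> that normal forms forget.\<close>

locale central_extension = group G + cyclic_factors n
  for G (structure) and n :: "'i \<Rightarrow> int" +
  fixes gen :: "'i \<Rightarrow> 'a" and z :: 'a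
    and \<rho> :: "'a \<Rightarrow> ('i \<times> int) list \<Rightarrow> ('i \<times> int) list" and \<phi> :: "'a \<Rightarrow> int"
  assumes gen_closed [simp]: "gen i \<in> carrier G"
    and generated: "carrier G = generate G (range gen)"
    and z_closed [simp]: "z \<in> carrier G"
    and central: "h \<in> carrier G \<Longrightarrow> z \<otimes> h = h \<otimes> z"
    and gen_order: "\<exists>t::int. gen i [^] n i = z [^] t"
    and \<rho>_hom: "\<rho> \<in> hom G (BijGroup Words)"
    and \<rho>_gen: "\<rho> (gen i) = translation i 1"
    and \<phi>_hom: "\<phi> \<in> hom G integer_group"
    and \<phi>_z: "\<phi> z \<noteq> 0"
begin

definition letters :: "('i \<times> int) list \<Rightarrow> 'a list" where
  "letters u = map (\<lambda>(i, k). gen i [^] k) u"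

definition val :: "('i \<times> int) list \<Rightarrow> 'a" where
  "val u = word_eval G (letters u)"

lemma letters_closed [simp]: "set (letters u) \<subseteq> carrier G"
  by (auto simp: letters_def)

lemma val_closed [simp]: "val u \<in> carrier G"
  by (simp add: val_def)

lemma val_simps [simp]:
  "val [] = \<one>" "val ((i, k) # u) = gen i [^] k \<otimes> val u" "val (u @ v) = val u \<otimes> val v"
  using letters_closed[of u] letters_closed[of v]
  by (simp_all add: val_def letters_def)

text \<open>Exponents are negated without reduction: \<open>inverse_word\<close> gives the inverse
  only up to a power of \<open>z\<close>.\<close>

lemma val_uminus: "val (map (\<lambda>(i, k). (i, - k)) (rev u)) = inv (val u)"
  by (induction u) (auto simp: inv_mult_group int_pow_neg)

lemma val_surj: "h \<in> carrier G \<Longrightarrow> \<exists>u. h = val u"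
  unfolding generated
proof (induction rule: generate.induct)
  case one
  then show ?case by (intro exI[of _ "[]"]) simp
next
  case (incl h)
  then obtain i where "h = gen i" by blast
  then show ?case by (intro exI[of _ "[(i, 1)]"]) simp
next
  case (inv h)
  then obtain i where "h = gen i" by blast
  then show ?case by (intro exI[of _ "[(i, -1)]"]) (simp add: int_pow_neg)
next
  case (eng g h)
  then obtain u v where "g = val u" "h = val v" by blast
  then show ?case by (intro exI[of _ "u @ v"]) simp
qed

section \<open>Normal forms as invariants of elements modulo powers of \<open>z\<close>\<close>

lemma \<rho>_closed [simp]: "h \<in> carrier G \<Longrightarrow> \<rho> h \<in> carrier (BijGroup Words)"
  using \<rho>_hom by (rule hom_in_carrier)

lemma \<rho>_val: "reduced w \<Longrightarrow> \<rho> (val u) w = act u w"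
proof (induction u)
  case Nil
  have "\<rho> \<one> = \<one>\<^bsub>BijGroup Words\<^esub>"
    using \<rho>_hom is_group group_BijGroup by (rule hom_one)
  with Nil show ?case by (simp add: BijGroup_def)
next
  case (Cons p u)
  obtain i k where p: "p = (i, k)" by (cases p)
  have "\<rho> (gen i [^] k) = translation i k"
    using hom_int_pow[OF \<rho>_hom gen_closed is_group group_BijGroup]
    by (simp add: \<rho>_gen translation_pow)
  moreover have "\<rho> (val (p # u)) = \<rho> (gen i [^] k) \<otimes>\<^bsub>BijGroup Words\<^esub> \<rho> (val u)"
    by (simp add: p hom_mult[OF \<rho>_hom])
  ultimately have "\<rho> (val (p # u)) w = translation i k (act u w)"
    using Cons by (simp add: BijGroup_apply translation_closed)
  with Cons.prems show ?case by (simp add: p translation_def reduced_act)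
qed

text \<open>The normal form is recovered from the group element by applying its permutation under
  \<open>\<rho>\<close> to the empty word.\<close>

lemma nf_cong: "val u = val v \<Longrightarrow> nf u = nf v"
  unfolding nf_def by (metis \<rho>_val reduced_Nil)

lemma central_pow: "h \<in> carrier G \<Longrightarrow> z [^] (t::int) \<otimes> h = h \<otimes> z [^] t"
proof -
  assume h: "h \<in> carrier G"
  have nat: "z [^] (m::nat) \<otimes> h = h \<otimes> z [^] m" for m
    using h central[OF h] by (simp add: group_commutes_pow)
  show ?thesis
  proof (cases "t < 0")
    case True
    have "inv (z [^] nat (- t)) \<otimes> h = h \<otimes> inv (z [^] nat (- t))"
      by (intro inv_commute nat nat_pow_closed z_closed h)
    then show ?thesis using True by (simp add: int_pow_def2 del: pow_nat)
  qed (use nat in \<open>simp add: int_pow_def2 del: pow_nat\<close>)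
qed

lemma gen_pow_mod: "\<exists>t::int. gen i [^] k = gen i [^] (k mod n i) \<otimes> z [^] t"
proof -
  obtain t :: int where t: "gen i [^] n i = z [^] t" using gen_order by blast
  have "gen i [^] (k mod n i + n i * (k div n i)) = gen i [^] (k mod n i) \<otimes> z [^] (t * (k div n i))"
    by (simp only: int_pow_mult gen_closed int_pow_pow[symmetric] t z_closed)
  then show ?thesis by auto
qed

lemma val_push: "\<exists>t::int. gen i [^] k \<otimes> val w = val (push i k w) \<otimes> z [^] t"
proof -
  obtain t :: int where t: "gen i [^] k = gen i [^] (k mod n i) \<otimes> z [^] t"
    using gen_pow_mod by blast
  have "gen i [^] k \<otimes> val w = val (push i k w) \<otimes> z [^] t"
    by (auto simp: t push_def m_assoc central_pow)
  then show ?thesis ..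
qed

lemma val_lmul: "\<exists>t::int. gen i [^] k \<otimes> val w = val (lmul i k w) \<otimes> z [^] t"
proof (cases "(i, k, w)" rule: lmul.cases)
  case (2 i' k' j l v)
  then show ?thesis
    using val_push[of i "k + l" v] val_push[of i k w]
    by (auto simp: int_pow_mult m_assoc)
qed (use val_push[of i k w] in auto)

text \<open>Each reduction of an exponent costs a power of \<open>z\<close>; centrality lets all of
  these be collected on the right.\<close>

lemma val_nf: "\<exists>t::int. val u = val (nf u) \<otimes> z [^] t"
proof (induction u)
  case Nil
  show ?case by (intro exI[of _ 0]) (simp add: nf_def)
next
  case (Cons p u)
  obtain i k where p: "p = (i, k)" by (cases p)
  obtain t s :: int where "val u = val (nf u) \<otimes> z [^] t"
    "gen i [^] k \<otimes> val (nf u) = val (lmul i k (nf u)) \<otimes> z [^] s"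
    using Cons val_lmul by blast
  then have "val (p # u) = val (nf (p # u)) \<otimes> z [^] (s + t)"
    by (simp add: p nf_def int_pow_mult flip: m_assoc)
  then show ?case ..
qed

section \<open>Conjugate elements have rotations with equal values\<close>

lemma \<phi>_conjugate:
  assumes "conjugate_in G a b" "a \<in> carrier G"
  shows "\<phi> a = \<phi> b"
proof -
  interpret \<phi>: group_hom G integer_group \<phi>
    by (intro group_hom.intro group_hom_axioms.intro is_group group_integer_group \<phi>_hom)
  obtain w where "w \<in> carrier G" "b = w \<otimes> a \<otimes> inv w"
    using assms(1) by (auto simp: conjugate_in_def)
  then show ?thesis using assms(2) by simp
qed

lemma val_cyclic_permutation: "cyclic_permutation v u \<Longrightarrow> conjugate_in G (val u) (val v)"
  unfolding val_def letters_def
  by (intro cyclic_permutation_conjugate cyclic_permutation_map) auto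

text \<open>Both values are the value of the common normal form times a power of \<open>z\<close>.
  As \<open>\<phi> z\<close> is a nonzero integer, equal images under \<open>\<phi>\<close> force
  equal exponents.\<close>

lemma nf_eq_imp_val_eq:
  assumes "nf u = nf v" "\<phi> (val u) = \<phi> (val v)"
  shows "val u = val v"
proof -
  interpret \<phi>: group_hom G integer_group \<phi>
    by (intro group_hom.intro group_hom_axioms.intro is_group group_integer_group \<phi>_hom)
  obtain s t :: int where st: "val u = val (nf u) \<otimes> z [^] s" "val v = val (nf u) \<otimes> z [^] t"
    using val_nf[of u] val_nf[of v] assms(1) by auto
  then have "s * \<phi> z = t * \<phi> z"
    using assms(2) by (simp add: \<phi>.hom_int_pow)
  then show ?thesis using st \<phi>_z by simp
qed

text \<open>Rotate both words until their normal forms \<open>c\<close> and \<open>d\<close> are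
  cyclically reduced. Then \<open>d\<close> is a rotation of \<open>c\<close>, and this rotation
  lifts to one of \<open>u\<close>; the remaining power of \<open>z\<close> is excluded by
  \<open>\<phi>\<close>.\<close>

lemma conjugate_rotations:
  assumes "conjugate_in G (val u) (val v)"
  shows "\<exists>u' v'. cyclic_permutation u' u \<and> cyclic_permutation v' v \<and> val u' = val v'"
proof -
  obtain c where c: "cyclically_reduced c"
    "\<And>c'. cyclic_permutation c' c \<Longrightarrow> \<exists>u'. cyclic_permutation u' u \<and> nf u' = c'"
    using cyclic_reduction[of u] by blast
  obtain d where d: "cyclically_reduced d"
    "\<And>d'. cyclic_permutation d' d \<Longrightarrow> \<exists>v'. cyclic_permutation v' v \<and> nf v' = d'"
    using cyclic_reduction[of v] by blast
  obtain u0 where u0: "cyclic_permutation u0 u" "nf u0 = c" using c(2) by force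
  obtain v' where v': "cyclic_permutation v' v" "nf v' = d" using d(2) by force
  have "conjugate_in G (val u0) (val v')"
    using assms val_cyclic_permutation[OF u0(1)] val_cyclic_permutation[OF v'(1)]
    by (meson conjugate_in_sym conjugate_in_trans val_closed)
  then obtain w where "val w \<otimes> val u0 \<otimes> inv (val w) = val v'"
    using val_surj by (auto simp: conjugate_in_def)
  \<comment> \<open>The conjugator may be replaced by the value of its normal form \<open>g\<close>,
    because the central factor \<open>z [^] t\<close> cancels in the conjugation.\<close>
  moreover obtain t :: int where "val w = val (nf w) \<otimes> z [^] t" using val_nf by blast
  moreover define g where "g = nf w"
  ultimately have "val g \<otimes> z [^] t \<otimes> val u0 \<otimes> inv (val g \<otimes> z [^] t) = val v'"
    by simp
  moreover have "z [^] t \<otimes> val u0 \<otimes> inv (z [^] t) = val u0"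
    by (simp add: central_pow m_assoc)
  moreover have "val g \<otimes> z [^] t \<otimes> val u0 \<otimes> inv (val g \<otimes> z [^] t)
      = val g \<otimes> (z [^] t \<otimes> val u0 \<otimes> inv (z [^] t)) \<otimes> inv (val g)"
    by (simp add: inv_mult_group m_assoc)
  ultimately have "val (g @ u0 @ map (\<lambda>(i, k). (i, - k)) (rev g)) = val v'"
    by (simp add: val_uminus m_assoc)
  from nf_cong[OF this] v'(2) have "nf (g @ u0 @ map (\<lambda>(i, k). (i, - k)) (rev g)) = d"
    by simp
  \<comment> \<open>Formal inverse and \<open>inverse_word\<close> differ in \<open>G\<close>, but
    they act alike on normal forms.\<close>
  moreover have "act (map (\<lambda>(i, k). (i, - k)) (rev g)) x = act (inverse_word g) x" for x
    unfolding inverse_word_def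
    using act_normalised[of "map (\<lambda>(i, k). (i, - k)) (rev g)" x] 
    by (simp add: comp_def case_prod_unfold)
  moreover have "act u0 x = act c x" if "reduced x" for x
    using act_nf[OF that, of u0] u0(2) by simp
  ultimately have gcg: "nf (g @ c @ inverse_word g) = d"
    by (simp add: nf_def reduced_act)
  then have "cyclic_permutation d c"
    using conjugate_cyclically_reduced[of c g] c(1) d(1) by (simp add: g_def)
  then obtain u' where u': "cyclic_permutation u' u" "nf u' = d" using c(2) by blast
  \<comment> \<open>Conjugates have the same image because the target of \<open>\<phi>\<close> is
    abelian.\<close>
  have "\<phi> (val u') = \<phi> (val v')"
    using \<phi>_conjugate[OF assms] \<phi>_conjugate[OF val_cyclic_permutation[OF u'(1)]]
      \<phi>_conjugate[OF val_cyclic_permutation[OF v'(1)]] by simp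
  then have "val u' = val v'" using u'(2) v'(2) by (intro nf_eq_imp_val_eq) simp_all
  with u'(1) v'(1) show ?thesis by blast
qed

section \<open>Vanishing of the permutation conjugacy length function\<close>

lemma words_over_letters:
  assumes "u \<in> words_over G (range gen)"
  shows "\<exists>u'. u = letters u'"
  using assms unfolding words_over_def
proof (induction u)
  case Nil
  show ?case by (intro exI[of _ "[]"]) (simp add: letters_def)
next
  case (Cons a u)
  then obtain u' where u': "u = letters u'" by blast
  obtain i where "a = gen i \<or> a = inv (gen i)" using Cons.hyps(1) by blast
  then have "a = gen i [^] (1::int) \<or> a = gen i [^] (- 1::int)" by (simp add: int_pow_neg)
  then obtain k where "a = gen i [^] (k::int)" by blast
  \<comment> \<open>Each letter becomes exactly one pair, so rotations of the two words
    correspond.\<close>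
  then show ?case using u' by (intro exI[of _ "(i, k) # u'"]) (simp add: letters_def)
qed

lemma word_length_one: "word_length G (range gen) \<one> = 0"
  unfolding word_length_def
  by (rule Least_equality) (auto simp: words_over_def)

text \<open>Once two rotations have the same value, the identity is a PC-conjugator, and it has
  length 0.\<close>

lemma PCL_pair_eq_0:
  assumes "u \<in> words_over G (range gen)" "v \<in> words_over G (range gen)"
    "conjugate_in G (word_eval G u) (word_eval G v)"
  shows "PCL_pair G (range gen) u v = 0"
proof -
  obtain p q where pq: "u = letters p" "v = letters q"
    using assms(1,2) words_over_letters by meson
  obtain p' q' where "cyclic_permutation p' p" "cyclic_permutation q' q" "val p' = val q'"
    using conjugate_rotations[of p q] assms(3) by (auto simp: pq val_def)
  moreover from this have "cyclic_permutation (letters p') u" "cyclic_permutation (letters q') v"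
    by (simp_all add: pq letters_def cyclic_permutation_map)
  moreover have "\<one> \<otimes> val p' = val q' \<otimes> \<one>" using \<open>val p' = val q'\<close> by simp
  ultimately have "PC_conjugator G u v \<one>"
    unfolding PC_conjugator_def val_def by blast
  then show ?thesis
    unfolding PCL_pair_def using word_length_one by (intro Least_eq_0) blast
qed

lemma PCL_eq_0: "PCL G (range gen) N = 0"
proof -
  \<comment> \<open>The pair of empty words shows that the value 0 is attained for every
    \<open>N\<close>.\<close>
  have geo: "geodesic G (range gen) []"
    by (simp add: geodesic_def words_over_def word_length_one)
  have "conjugate_in G \<one> \<one>" by (auto simp: conjugate_in_def)
  then have "{PCL_pair G (range gen) u v | u v.
     geodesic G (range gen) u \<and> geodesic G (range gen) v \<and>
     conjugate_in G (word_eval G u) (word_eval G v) \<and> length u + length v \<le> N} = {0}"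
    using geo PCL_pair_eq_0 
    by (auto simp: geodesic_def intro!: exI[of _ "[]"])
  then show ?thesis by (simp add: PCL_def)
qed

end

section \<open>Homomorphisms out of presented groups\<close>

definition gword_eval :: "('g, 'r) monoid_scheme \<Rightarrow> ('s \<Rightarrow> 'g) \<Rightarrow> 's gword \<Rightarrow> 'g" where
  "gword_eval H f u = word_eval H (map (\<lambda>(s, e). if e then f s else inv\<^bsub>H\<^esub> f s) u)"

lemma gword_eval_Nil [simp]: "gword_eval H f [] = \<one>\<^bsub>H\<^esub>"
  and gword_eval_Cons [simp]:
    "gword_eval H f ((s, e) # u) = (if e then f s else inv\<^bsub>H\<^esub> f s) \<otimes>\<^bsub>H\<^esub> gword_eval H f u"
  by (simp_all add: gword_eval_def)

context group
begin

lemma gword_eval_closed [simp]: "range f \<subseteq> carrier G \<Longrightarrow> gword_eval G f u \<in> carrier G"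
  unfolding gword_eval_def by (intro word_eval_closed) (auto simp: image_subset_iff)

lemma gword_eval_append:
  "range f \<subseteq> carrier G \<Longrightarrow> gword_eval G f (u @ v) = gword_eval G f u \<otimes> gword_eval G f v"
  unfolding gword_eval_def map_append by (intro word_eval_append) (auto simp: image_subset_iff)

lemma gword_eval_pres_eq:
  assumes "pres_eq R u v" "range f \<subseteq> carrier G"
    "\<And>r s. (r, s) \<in> R \<Longrightarrow> gword_eval G f r = gword_eval G f s"
  shows "gword_eval G f u = gword_eval G f v"
  using assms(1)
proof induction
  case (cancel p s e q)
  have "f s \<in> carrier G" using assms(2) by auto
  then have "gword_eval G f [(s, e), (s, \<not> e)] = \<one>" by simp
  then show ?case unfolding gword_eval_append[OF assms(2)] using assms(2) by simp
next
  case (relator r s p q)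
  then show ?case using assms(2,3) by (simp add: gword_eval_append)
qed simp_all

text \<open>Von Dyck's theorem. The map evaluates a chosen representative;
  \<open>gword_eval_pres_eq\<close> makes the choice irrelevant.\<close>

lemma presented_group_lift:
  assumes "range f \<subseteq> carrier G" "\<And>r s. (r, s) \<in> R \<Longrightarrow> gword_eval G f r = gword_eval G f s"
  obtains h where "h \<in> hom (presented_group R) G" "\<And>u. h (pres_class R u) = gword_eval G f u"
proof -
  define h where "h A = gword_eval G f (SOME u. A = pres_class R u)" for A
  have h: "h (pres_class R u) = gword_eval G f u" for u
  proof -
    have "pres_class R u = pres_class R (SOME v. pres_class R u = pres_class R v)"
      by (rule someI) (rule HOL.refl)
    then have "pres_eq R u (SOME v. pres_class R u = pres_class R v)"
      by (simp only: pres_class_eq_iff)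
    then show ?thesis unfolding h_def using gword_eval_pres_eq assms by metis
  qed
  moreover have "h \<in> hom (presented_group R) G"
  proof (rule homI)
    fix A B assume "A \<in> carrier (presented_group R)" "B \<in> carrier (presented_group R)"
    then obtain u v where "A = pres_class R u" "B = pres_class R v"
      by (auto simp: presented_group_def)
    then show "h (A \<otimes>\<^bsub>presented_group R\<^esub> B) = h A \<otimes> h B"
      by (simp add: presented_group_mult h gword_eval_append assms(1))
  next
    fix A assume "A \<in> carrier (presented_group R)"
    then obtain u where "A = pres_class R u" by (auto simp: presented_group_def)
    then show "h A \<in> carrier G" by (simp add: h assms(1))
  qed
  ultimately show ?thesis using that by blast
qed

lemma gword_eval_generate:
  assumes "range f \<subseteq> generate G X" "X \<subseteq> carrier G"
  shows "gword_eval G f u \<in> generate G X"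
proof (induction u)
  case Nil
  show ?case by (simp add: generate.one)
next
  case (Cons l u)
  obtain s e where l: "l = (s, e)" by (cases l)
  have "f s \<in> generate G X" using assms(1) by blast
  then show ?case
    using Cons generate_m_inv_closed[OF assms(2)] by (auto simp: l intro: generate.eng)
qed

lemma central_generate:
  assumes "z \<in> carrier G" "X \<subseteq> carrier G" "\<And>x. x \<in> X \<Longrightarrow> z \<otimes> x = x \<otimes> z"
    and "h \<in> generate G X"
  shows "z \<otimes> h = h \<otimes> z"
  using assms(4)
proof induction
  case (inv h)
  then show ?case using inv_commute[of h z] assms by auto
next
  case (eng g h)
  then have "g \<in> carrier G" "h \<in> carrier G" using generate_in_carrier[OF assms(2)] by auto
  then show ?case using eng.IH assms(1) by (metis m_assoc)
qed (use assms in auto)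

section \<open>Alternating words and classes of words as products\<close>

lemma gword_eval_alt_word_double:
  "range f \<subseteq> carrier G \<Longrightarrow> gword_eval G f (alt_word (2 * k) s t) = (f s \<otimes> f t) [^] k"
proof (induction k)
  case (Suc k)
  have "f s \<in> carrier G" "f t \<in> carrier G" using Suc.prems by auto
  with Suc show ?case
    using nat_pow_Suc2[of "f s \<otimes> f t" k] by (simp add: m_assoc del: nat_pow_Suc)
qed simp

lemma pow_mult_swap:
  "a \<in> carrier G \<Longrightarrow> b \<in> carrier G \<Longrightarrow> a \<otimes> (b \<otimes> a) [^] (k::nat) = (a \<otimes> b) [^] k \<otimes> a"
  by (induction k) (simp_all add: m_assoc, simp flip: m_assoc)

text \<open>Behind the first letter stands an alternating word of even length starting with
  \<open>t\<close>; \<open>pow_mult_swap\<close> moves the single factor \<open>f s\<close> to the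
  end.\<close>

lemma gword_eval_alt_word_Suc_double:
  assumes "range f \<subseteq> carrier G"
  shows "gword_eval G f (alt_word (Suc (2 * k)) s t) = (f s \<otimes> f t) [^] k \<otimes> f s"
proof -
  have "f s \<in> carrier G" "f t \<in> carrier G" using assms by auto
  then show ?thesis
    using gword_eval_alt_word_double[OF assms, of k t s] by (simp add: pow_mult_swap)
qed

end

text \<open>Replaces classes of words by products of generator classes, so that the group laws take
  over from the congruence.\<close>

lemma pres_class_eq_gword_eval:
  "pres_class R u = gword_eval (presented_group R) (\<lambda>s. pres_class R [(s, True)]) u"
proof (induction u)
  case Nil
  show ?case by (simp add: presented_group_def)
next
  case (Cons l u)
  interpret group "presented_group R" by (rule group_presented_group)
  obtain s e where l: "l = (s, e)" by (cases l)
  have "inv\<^bsub>presented_group R\<^esub> pres_class R [(s, True)] = pres_class R [(s, False)]"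
  proof (rule inv_equality)
    have "pres_class R ([] @ [(s, False), (s, \<not> False)] @ []) = pres_class R ([] @ [])"
      unfolding pres_class_eq_iff by (rule pres_eq.cancel)
    then show "pres_class R [(s, False)] \<otimes>\<^bsub>presented_group R\<^esub> pres_class R [(s, True)]
        = \<one>\<^bsub>presented_group R\<^esub>"
      unfolding presented_group_mult by (simp add: presented_group_def)
  qed (auto simp: presented_group_def)
  then show ?case
    using presented_group_mult[of R "[(s, e)]" u] by (cases e) (simp_all add: l flip: Cons)
qed

section \<open>Dihedral Artin groups\<close>

context
  fixes m :: nat
begin

definition class_gen :: "artin_gen \<Rightarrow> artin_gen gword set" where
  "class_gen s = pres_class (artin_relators m) [(s, True)]"

lemma group_dihedral_artin: "group (dihedral_artin m)"
  by (simp add: dihedral_artin_def group_presented_group)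

lemma class_gen_closed: "class_gen s \<in> carrier (dihedral_artin m)"
  by (simp add: class_gen_def dihedral_artin_def presented_group_def)

lemma pres_class_dihedral:
  "pres_class (artin_relators m) u = gword_eval (dihedral_artin m) class_gen u"
  by (simp add: dihedral_artin_def class_gen_def[abs_def] flip: pres_class_eq_gword_eval)

lemma dihedral_artin_relation:
  "gword_eval (dihedral_artin m) class_gen (alt_word m gen_a gen_b)
     = gword_eval (dihedral_artin m) class_gen (alt_word m gen_b gen_a)"
  using pres_eq.relator[of "alt_word m gen_a gen_b" "alt_word m gen_b gen_a" "artin_relators m" "[]" "[]"]
  by (simp add: artin_relators_def flip: pres_class_dihedral pres_class_eq_iff)

lemma dihedral_artin_generated:
  assumes "X \<subseteq> carrier (dihedral_artin m)"
    "class_gen gen_a \<in> generate (dihedral_artin m) X" "class_gen gen_b \<in> generate (dihedral_artin m) X"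
  shows "carrier (dihedral_artin m) = generate (dihedral_artin m) X"
proof
  have "class_gen s \<in> generate (dihedral_artin m) X" for s
    using assms(2,3) by (cases s) simp_all
  then have "range class_gen \<subseteq> generate (dihedral_artin m) X" by blast
  then have "pres_class (artin_relators m) u \<in> generate (dihedral_artin m) X" for u
    unfolding pres_class_dihedral
    by (rule group.gword_eval_generate[OF group_dihedral_artin _ assms(1)])
  moreover have "carrier (dihedral_artin m) = range (pres_class (artin_relators m))"
    by (simp add: dihedral_artin_def presented_group_def)
  ultimately show "carrier (dihedral_artin m) \<subseteq> generate (dihedral_artin m) X" by auto
qed (simp add: group.generate_incl[OF group_dihedral_artin assms(1)])

end

text \<open>Indexes the two factors by \<open>bool\<close>, with \<open>True\<close> for
  \<open>x\<close> and \<open>False\<close> for \<open>y\<close>, as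
  \<open>central_extension\<close> expects an indexed family.\<close>

definition gen_xy :: "nat \<Rightarrow> bool \<Rightarrow> artin_gen gword set" where
  "gen_xy m i = (if i then free_product_gen_x m else free_product_gen_y m)"

lemma range_gen_xy: "range (gen_xy m) = free_product_gens m"
  by (auto simp: gen_xy_def free_product_gens_def UNIV_bool)

lemma free_product_gens_closed:
  "free_product_gen_x m \<in> carrier (dihedral_artin m)"
  "free_product_gen_y m \<in> carrier (dihedral_artin m)"
  by (simp_all add: free_product_gen_x_def free_product_gen_y_def dihedral_artin_def
      presented_group_def)

text \<open>Collects what each parity of \<open>m\<close> has to supply; centrality of
  \<open>z\<close> and generation by \<open>X\<close> are to be checked only for the Artin
  generators.\<close>

lemma PCL_dihedral_artin_eq_0:
  fixes n :: "bool \<Rightarrow> int" and t :: "bool \<Rightarrow> int"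
  assumes gens: "class_gen m gen_a \<in> generate (dihedral_artin m) (free_product_gens m)"
      "class_gen m gen_b \<in> generate (dihedral_artin m) (free_product_gens m)"
    and z: "z \<in> carrier (dihedral_artin m)"
      "\<And>s. z \<otimes>\<^bsub>dihedral_artin m\<^esub> class_gen m s = class_gen m s \<otimes>\<^bsub>dihedral_artin m\<^esub> z"
    and order: "\<And>i. gen_xy m i [^]\<^bsub>dihedral_artin m\<^esub> n i = z [^]\<^bsub>dihedral_artin m\<^esub> t i"
    and \<rho>: "\<rho> \<in> hom (dihedral_artin m) (BijGroup {w. cyclic_factors.reduced n w})"
      "\<And>i. \<rho> (gen_xy m i) = cyclic_factors.translation n i 1"
    and \<phi>: "\<phi> \<in> hom (dihedral_artin m) integer_group" "\<phi> z \<noteq> 0"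
  shows "PCL (dihedral_artin m) (free_product_gens m) N = 0"
proof -
  let ?G = "dihedral_artin m"
  interpret group ?G by (rule group_dihedral_artin)
  have X: "range (class_gen m) \<subseteq> carrier ?G" using class_gen_closed by blast
  have gen: "generate ?G (range (class_gen m)) = carrier ?G"
    by (intro dihedral_artin_generated[OF X, symmetric] generate.incl) auto
  have "z \<otimes>\<^bsub>?G\<^esub> h = h \<otimes>\<^bsub>?G\<^esub> z" if "h \<in> carrier ?G" for h
  proof (rule central_generate[OF z(1) X])
    show "z \<otimes>\<^bsub>?G\<^esub> x = x \<otimes>\<^bsub>?G\<^esub> z" if "x \<in> range (class_gen m)" for x
      using that z(2) by blast
  qed (simp add: gen that)
  note comm = this
  have gen': "carrier ?G = generate ?G (free_product_gens m)"
    using gens by (intro dihedral_artin_generated) (auto simp: free_product_gens_def free_product_gens_closed)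
  interpret central_extension ?G n "gen_xy m" z \<rho> \<phi>
  proof unfold_locales
    show "carrier ?G = generate ?G (range (gen_xy m))" using gen' by (simp only: range_gen_xy)
    show "gen_xy m i \<in> carrier ?G" for i by (simp add: gen_xy_def free_product_gens_closed)
    show "\<exists>t::int. gen_xy m i [^]\<^bsub>?G\<^esub> n i = z [^]\<^bsub>?G\<^esub> t" for i using order by blast
  qed (use z comm \<rho> \<phi> in auto)
  show ?thesis using PCL_eq_0[of N] by (simp add: range_gen_xy)
qed

section \<open>Passing between the Artin generators and \<open>x\<close>, \<open>y\<close>\<close>

context group
begin

text \<open>The values of \<open>f\<close> come from solving \<open>y = ab\<close> and
  \<open>x = (ab)^k a\<close> for \<open>a\<close> and \<open>b\<close>. Both sides of the Artin
  relation then evaluate to \<open>x\<close>.\<close>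

lemma odd_presentation_in_xy:
  assumes x: "x \<in> carrier G" and y: "y \<in> carrier G" and rel: "x \<otimes> x = y [^] Suc (2 * k)"
  defines "f \<equiv> case_artin_gen (inv (y [^] k) \<otimes> x) (inv x \<otimes> y [^] Suc k)"
  shows "gword_eval G f (alt_word (Suc (2 * k)) gen_a gen_b) = x"
    and "gword_eval G f (alt_word (Suc (2 * k)) gen_b gen_a) = x"
    and "gword_eval G f [(gen_a, True), (gen_b, True)] = y"
    and "range f \<subseteq> carrier G"
proof -
  show closed: "range f \<subseteq> carrier G"
    using x y by (auto simp: f_def split: artin_gen.splits)
  have ab: "f gen_a \<otimes> f gen_b = y"
    using x y by (simp add: f_def inv_mult_group m_assoc inv_solve_left' flip: nat_pow_Suc2)
      (simp flip: m_assoc)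
  show "gword_eval G f [(gen_a, True), (gen_b, True)] = y"
    using ab x y by (simp add: f_def)
  show "gword_eval G f (alt_word (Suc (2 * k)) gen_a gen_b) = x"
    unfolding gword_eval_alt_word_Suc_double[OF closed] ab
    using x y by (simp add: f_def flip: m_assoc)
  have "gword_eval G f (alt_word (Suc (2 * k)) gen_b gen_a) = f gen_b \<otimes> y [^] k"
    unfolding gword_eval_alt_word_Suc_double[OF closed]
    using pow_mult_swap[of "f gen_b" "f gen_a" k] closed by (simp add: ab image_subset_iff)
  also have "\<dots> = inv x \<otimes> y [^] Suc (2 * k)"
    using x y nat_pow_mult[OF y, of "Suc k" k] by (simp add: f_def m_assoc mult_2 del: nat_pow_Suc)
  also have "\<dots> = inv x \<otimes> (x \<otimes> x)" by (simp only: rel)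
  also have "\<dots> = x" using x by (simp flip: m_assoc)
  finally show "gword_eval G f (alt_word (Suc (2 * k)) gen_b gen_a) = x" .
qed

text \<open>Here \<open>y = a\<close> and \<open>x = ab\<close> are solved for \<open>a\<close> and
  \<open>b\<close>. The word starting with \<open>b\<close> is the conjugate of
  \<open>x [^] p\<close> by \<open>inv y\<close>, which commutation with \<open>y\<close> makes
  trivial.\<close>

lemma even_presentation_in_xy:
  assumes x: "x \<in> carrier G" and y: "y \<in> carrier G" and rel: "x [^] p \<otimes> y = y \<otimes> x [^] (p::nat)"
  defines "f \<equiv> case_artin_gen y (inv y \<otimes> x)"
  shows "gword_eval G f (alt_word (2 * p) gen_a gen_b) = x [^] p"
    and "gword_eval G f (alt_word (2 * p) gen_b gen_a) = x [^] p"
    and "gword_eval G f [(gen_a, True), (gen_b, True)] = x"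
    and "range f \<subseteq> carrier G"
proof -
  show closed: "range f \<subseteq> carrier G"
    using x y by (auto simp: f_def split: artin_gen.splits)
  have ab: "f gen_a \<otimes> f gen_b = x"
    using x y by (simp add: f_def flip: m_assoc)
  show "gword_eval G f [(gen_a, True), (gen_b, True)] = x"
    using ab x y by (simp add: f_def)
  show "gword_eval G f (alt_word (2 * p) gen_a gen_b) = x [^] p"
    unfolding gword_eval_alt_word_double[OF closed] ab ..
  have "y \<otimes> (f gen_b \<otimes> f gen_a) [^] p = x [^] p \<otimes> y"
    using pow_mult_swap[of y "f gen_b" p] x y ab by (simp add: f_def)
  then have "(f gen_b \<otimes> f gen_a) [^] p = x [^] p"
    using x y by (simp add: rel f_def)
  then show "gword_eval G f (alt_word (2 * p) gen_b gen_a) = x [^] p"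
    unfolding gword_eval_alt_word_double[OF closed] .
qed

end

text \<open>The universal property of the presentation with \<open>x^2 = y^m\<close>, in just the
  form needed to construct \<open>\<rho>\<close> and \<open>\<phi>\<close>.\<close>

lemma odd_dihedral_artin_lift:
  assumes "group H" "x \<in> carrier H" "y \<in> carrier H" "x \<otimes>\<^bsub>H\<^esub> x = y [^]\<^bsub>H\<^esub> m" "odd m"
  obtains h where "h \<in> hom (dihedral_artin m) H"
    "h (free_product_gen_x m) = x" "h (free_product_gen_y m) = y"
proof -
  interpret group H by fact
  obtain k where m: "m = Suc (2 * k)" using \<open>odd m\<close> by (auto elim: oddE)
  define f where "f = case_artin_gen (inv\<^bsub>H\<^esub> (y [^]\<^bsub>H\<^esub> k) \<otimes>\<^bsub>H\<^esub> x) (inv\<^bsub>H\<^esub> x \<otimes>\<^bsub>H\<^esub> y [^]\<^bsub>H\<^esub> Suc k)"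
  note f = odd_presentation_in_xy[OF assms(2,3) assms(4)[unfolded m], folded f_def m]
  from f(4) obtain h where "h \<in> hom (dihedral_artin m) H"
    "\<And>u. h (pres_class (artin_relators m) u) = gword_eval H f u"
    using presented_group_lift[OF f(4), of "artin_relators m"] f(1,2)
    by (auto simp: dihedral_artin_def artin_relators_def)
  then show ?thesis
    using f(1,3) \<open>odd m\<close> that by (simp add: free_product_gen_x_def free_product_gen_y_def)
qed

lemma even_dihedral_artin_lift:
  assumes "group H" "x \<in> carrier H" "y \<in> carrier H"
    "x [^]\<^bsub>H\<^esub> p \<otimes>\<^bsub>H\<^esub> y = y \<otimes>\<^bsub>H\<^esub> x [^]\<^bsub>H\<^esub> (p::nat)" "m = 2 * p"
  obtains h where "h \<in> hom (dihedral_artin m) H"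
    "h (free_product_gen_x m) = x" "h (free_product_gen_y m) = y"
proof -
  interpret group H by fact
  define f where "f = case_artin_gen y (inv\<^bsub>H\<^esub> y \<otimes>\<^bsub>H\<^esub> x)"
  note f = even_presentation_in_xy[OF assms(2-4), folded f_def \<open>m = 2 * p\<close>]
  from f(4) obtain h where h: "h \<in> hom (dihedral_artin m) H"
    "\<And>u. h (pres_class (artin_relators m) u) = gword_eval H f u"
    using presented_group_lift[OF f(4), of "artin_relators m"] f(1,2)
    by (auto simp: dihedral_artin_def artin_relators_def)
  moreover have "gword_eval H f [(gen_a, True)] = y" using assms(3) by (simp add: f_def)
  ultimately show ?thesis
    using f(3) \<open>m = 2 * p\<close> that by (simp add: free_product_gen_x_def free_product_gen_y_def)
qed

section \<open>The two parities of \<open>m\<close>\<close>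

lemma PCL_odd_dihedral_artin:
  assumes "odd m"
  shows "PCL (dihedral_artin m) (free_product_gens m) N = 0"
proof -
  let ?G = "dihedral_artin m" and ?x = "free_product_gen_x m" and ?y = "free_product_gen_y m"
  \<comment> \<open>The orders of \<open>x\<close> and \<open>y\<close> modulo
    \<open>z = x^2 = y^m\<close>.\<close>
  define n :: "bool \<Rightarrow> int" where "n i = (if i then 2 else int m)" for i
  interpret cyclic_factors n .
  interpret group ?G by (rule group_dihedral_artin)
  interpret B: group "BijGroup Words" by (rule group_BijGroup)
  obtain k where m: "m = Suc (2 * k)" using \<open>odd m\<close> by (auto elim: oddE)
  define a b where "a = class_gen m gen_a" and "b = class_gen m gen_b"
  have ab: "a \<in> carrier ?G" "b \<in> carrier ?G" by (simp_all add: a_def b_def class_gen_closed)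
  have closed: "range (class_gen m) \<subseteq> carrier ?G" using class_gen_closed by blast
  have y: "?y = a \<otimes>\<^bsub>?G\<^esub> b"
    using ab \<open>odd m\<close> by (simp add: free_product_gen_y_def pres_class_dihedral flip: a_def b_def)
  have alt: "?x = gword_eval ?G (class_gen m) (alt_word m gen_a gen_b)"
    using \<open>odd m\<close> by (simp add: free_product_gen_x_def pres_class_dihedral)
  have x: "?x = (a \<otimes>\<^bsub>?G\<^esub> b) [^]\<^bsub>?G\<^esub> k \<otimes>\<^bsub>?G\<^esub> a"
    using gword_eval_alt_word_Suc_double[OF closed, of k gen_a gen_b]
    unfolding alt by (simp only: m[symmetric] a_def b_def)
  have x': "?x = (b \<otimes>\<^bsub>?G\<^esub> a) [^]\<^bsub>?G\<^esub> k \<otimes>\<^bsub>?G\<^esub> b"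
    using gword_eval_alt_word_Suc_double[OF closed, of k gen_b gen_a]
    unfolding alt dihedral_artin_relation by (simp only: m[symmetric] a_def b_def)
  note xy = free_product_gens_closed[of m]
  \<comment> \<open>The element \<open>x\<close> is the Garside element: for odd \<open>m\<close>,
    conjugation by it exchanges \<open>a\<close> and \<open>b\<close>, so its square is
    central.\<close>
  have xa: "?x \<otimes>\<^bsub>?G\<^esub> a = b \<otimes>\<^bsub>?G\<^esub> ?x"
  proof -
    have "b \<otimes>\<^bsub>?G\<^esub> ?x = (b \<otimes>\<^bsub>?G\<^esub> (a \<otimes>\<^bsub>?G\<^esub> b) [^]\<^bsub>?G\<^esub> k) \<otimes>\<^bsub>?G\<^esub> a" using ab by (simp add: x m_assoc)
    also have "\<dots> = ?x \<otimes>\<^bsub>?G\<^esub> a" using ab by (simp add: pow_mult_swap x')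
    finally show ?thesis ..
  qed
  have xb: "?x \<otimes>\<^bsub>?G\<^esub> b = a \<otimes>\<^bsub>?G\<^esub> ?x"
  proof -
    have "a \<otimes>\<^bsub>?G\<^esub> ?x = (a \<otimes>\<^bsub>?G\<^esub> (b \<otimes>\<^bsub>?G\<^esub> a) [^]\<^bsub>?G\<^esub> k) \<otimes>\<^bsub>?G\<^esub> b" using ab by (simp add: x' m_assoc)
    also have "\<dots> = ?x \<otimes>\<^bsub>?G\<^esub> b" using ab by (simp add: pow_mult_swap x)
    finally show ?thesis ..
  qed
  have rel: "?x \<otimes>\<^bsub>?G\<^esub> ?x = ?y [^]\<^bsub>?G\<^esub> m"
  proof -
    have "?x \<otimes>\<^bsub>?G\<^esub> ?x = (a \<otimes>\<^bsub>?G\<^esub> b) [^]\<^bsub>?G\<^esub> k \<otimes>\<^bsub>?G\<^esub> (a \<otimes>\<^bsub>?G\<^esub> ?x)"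
      using ab xy by (simp add: x m_assoc)
    also have "a \<otimes>\<^bsub>?G\<^esub> ?x = (a \<otimes>\<^bsub>?G\<^esub> b) [^]\<^bsub>?G\<^esub> Suc k"
      using ab by (simp only: xb[symmetric]) (simp add: x m_assoc)
    also have "(a \<otimes>\<^bsub>?G\<^esub> b) [^]\<^bsub>?G\<^esub> k \<otimes>\<^bsub>?G\<^esub> \<dots> = ?y [^]\<^bsub>?G\<^esub> m"
      using ab by (simp only: nat_pow_mult m_closed y) (simp add: m mult_2)
    finally show ?thesis .
  qed
  have xX: "?x \<in> generate ?G (free_product_gens m)" and yX: "?y \<in> generate ?G (free_product_gens m)"
    by (auto simp: free_product_gens_def intro: generate.incl)
  have sub: "subgroup (generate ?G (free_product_gens m)) ?G"
    using xy by (intro generate_is_subgroup) (auto simp: free_product_gens_def)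
  have pow: "h [^]\<^bsub>?G\<^esub> (j::nat) \<in> generate ?G (free_product_gens m)"
    if "h \<in> generate ?G (free_product_gens m)" for h j
    using that sub by (induction j) (auto simp: subgroup.one_closed subgroup.m_closed)
  have "a = inv\<^bsub>?G\<^esub> (?y [^]\<^bsub>?G\<^esub> k) \<otimes>\<^bsub>?G\<^esub> ?x"
    using ab by (simp add: x y flip: m_assoc)
  then have aX: "a \<in> generate ?G (free_product_gens m)"
    using sub xX yX pow by (metis subgroup.m_closed subgroup.m_inv_closed)
  have "b = inv\<^bsub>?G\<^esub> a \<otimes>\<^bsub>?G\<^esub> ?y" using ab by (simp add: y flip: m_assoc)
  then have bX: "b \<in> generate ?G (free_product_gens m)"
    using sub aX yX by (metis subgroup.m_closed subgroup.m_inv_closed)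
  have z: "?x \<otimes>\<^bsub>?G\<^esub> ?x \<otimes>\<^bsub>?G\<^esub> class_gen m s = class_gen m s \<otimes>\<^bsub>?G\<^esub> (?x \<otimes>\<^bsub>?G\<^esub> ?x)" for s
  proof -
    have "?x \<otimes>\<^bsub>?G\<^esub> ?x \<otimes>\<^bsub>?G\<^esub> c = c \<otimes>\<^bsub>?G\<^esub> (?x \<otimes>\<^bsub>?G\<^esub> ?x)"
      if "c \<in> carrier ?G" "d \<in> carrier ?G" "?x \<otimes>\<^bsub>?G\<^esub> c = d \<otimes>\<^bsub>?G\<^esub> ?x" "?x \<otimes>\<^bsub>?G\<^esub> d = c \<otimes>\<^bsub>?G\<^esub> ?x" for c d
      using that xy by (metis m_assoc)
    then show ?thesis using xa xb ab by (cases s) (auto simp: a_def b_def)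
  qed
  \<comment> \<open>Both sides are the identity permutation, since the translations have orders
    dividing 2 and \<open>m\<close>.\<close>
  have "translation True 1 \<otimes>\<^bsub>BijGroup Words\<^esub> translation True 1
      = translation False 1 [^]\<^bsub>BijGroup Words\<^esub> m"
    using hom_mult[OF translation_hom, of 1 1 True] translation_order[of True]
      translation_pow[of False "int m"] translation_order[of False]
    by (simp add: n_def int_pow_int)
  then obtain \<rho> where \<rho>: "\<rho> \<in> hom ?G (BijGroup Words)" "\<rho> ?x = translation True 1"
    "\<rho> ?y = translation False 1"
    using odd_dihedral_artin_lift[OF group_BijGroup translation_closed translation_closed] \<open>odd m\<close>
    by metis
  \<comment> \<open>The weights \<open>m\<close> and 2 respect \<open>x^2 = y^m\<close> because
    \<open>m + m = 2 * m\<close>; thus \<open>z\<close> is sent to \<open>2 * m\<close>.\<close>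
  obtain \<phi> where \<phi>: "\<phi> \<in> hom ?G integer_group" "\<phi> ?x = int m" "\<phi> ?y = 2"
    using odd_dihedral_artin_lift[of integer_group "int m" 2 m] \<open>odd m\<close> by auto
  show ?thesis
  proof (rule PCL_dihedral_artin_eq_0[where n = n and z = "?x \<otimes>\<^bsub>?G\<^esub> ?x" and t = "\<lambda>_. 1" and \<rho> = \<rho> and \<phi> = \<phi>])
    show "gen_xy m i [^]\<^bsub>?G\<^esub> n i = (?x \<otimes>\<^bsub>?G\<^esub> ?x) [^]\<^bsub>?G\<^esub> (1::int)" for i
      using xy rel by (simp add: gen_xy_def n_def int_pow_int) (simp add: int_pow_def2 numeral_2_eq_2)
    show "\<phi> (?x \<otimes>\<^bsub>?G\<^esub> ?x) \<noteq> 0"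
      using hom_mult[OF \<phi>(1) xy(1) xy(1)] \<phi>(2) \<open>odd m\<close> by (auto simp: odd_pos)
    show "\<rho> (gen_xy m i) = translation i 1" for i
      using \<rho> by (simp add: gen_xy_def)
  qed (use aX bX z xy \<rho>(1) \<phi>(1) in \<open>auto simp: a_def b_def\<close>)
qed

lemma PCL_even_dihedral_artin:
  assumes "m = 2 * p" "p \<noteq> 0"
  shows "PCL (dihedral_artin m) (free_product_gens m) N = 0"
proof -
  let ?G = "dihedral_artin m" and ?x = "free_product_gen_x m" and ?y = "free_product_gen_y m"
  \<comment> \<open>Modulo \<open>z = x^p\<close> the generator \<open>x\<close> has order
    \<open>p\<close>, while \<open>y\<close> stays of infinite order, encoded by 0.\<close>
  define n :: "bool \<Rightarrow> int" where "n i = (if i then int p else 0)" for i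
  interpret cyclic_factors n .
  interpret group ?G by (rule group_dihedral_artin)
  interpret B: group "BijGroup Words" by (rule group_BijGroup)
  define a b where "a = class_gen m gen_a" and "b = class_gen m gen_b"
  have ab: "a \<in> carrier ?G" "b \<in> carrier ?G" by (simp_all add: a_def b_def class_gen_closed)
  have closed: "range (class_gen m) \<subseteq> carrier ?G" using class_gen_closed by blast
  have "even m" using assms(1) by simp
  then have y: "?y = a"
    using ab by (simp add: free_product_gen_y_def pres_class_dihedral flip: a_def)
  have x: "?x = a \<otimes>\<^bsub>?G\<^esub> b"
    using ab \<open>even m\<close> by (simp add: free_product_gen_x_def pres_class_dihedral flip: a_def b_def)
  have rel: "(a \<otimes>\<^bsub>?G\<^esub> b) [^]\<^bsub>?G\<^esub> p = (b \<otimes>\<^bsub>?G\<^esub> a) [^]\<^bsub>?G\<^esub> p"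
    using dihedral_artin_relation[of m] gword_eval_alt_word_double[OF closed, of p]
    by (simp add: a_def b_def assms(1))
  note xy = free_product_gens_closed[of m]
  \<comment> \<open>By \<open>pow_mult_swap\<close>, moving \<open>a\<close> or \<open>b\<close>
    across turns \<open>(ab)^p\<close> into \<open>(ba)^p\<close> or back, and the Artin relation
    says that these are equal.\<close>
  have z: "?x [^]\<^bsub>?G\<^esub> p \<otimes>\<^bsub>?G\<^esub> class_gen m s = class_gen m s \<otimes>\<^bsub>?G\<^esub> ?x [^]\<^bsub>?G\<^esub> p" for s
    using pow_mult_swap[OF ab, of p] pow_mult_swap[OF ab(2,1), of p] rel
    by (cases s) (simp_all add: x flip: a_def b_def)
  have xX: "?x \<in> generate ?G (free_product_gens m)" and aX: "a \<in> generate ?G (free_product_gens m)"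
    by (auto simp: free_product_gens_def y[symmetric] intro: generate.incl)
  have sub: "subgroup (generate ?G (free_product_gens m)) ?G"
    using xy by (intro generate_is_subgroup) (auto simp: free_product_gens_def)
  have "b = inv\<^bsub>?G\<^esub> a \<otimes>\<^bsub>?G\<^esub> ?x" using ab by (simp add: x flip: m_assoc)
  then have bX: "b \<in> generate ?G (free_product_gens m)"
    using sub aX xX by (metis subgroup.m_closed subgroup.m_inv_closed)
  have "translation True 1 [^]\<^bsub>BijGroup Words\<^esub> p = \<one>\<^bsub>BijGroup Words\<^esub>"
    using translation_pow[of True "int p"] translation_order[of True] by (simp add: n_def int_pow_int)
  then obtain \<rho> where \<rho>: "\<rho> \<in> hom ?G (BijGroup Words)" "\<rho> ?x = translation True 1"
    "\<rho> ?y = translation False 1"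
    using even_dihedral_artin_lift[OF group_BijGroup, of "translation True 1" Words "translation False 1" p m]
      translation_closed assms(1) by auto
  \<comment> \<open>Any integer weights respect a commutation relation; with weight 1 for
    \<open>x\<close>, the element \<open>z\<close> is sent to \<open>p\<close>, which is
    nonzero.\<close>
  obtain \<phi> where \<phi>: "\<phi> \<in> hom ?G integer_group" "\<phi> ?x = 1" "\<phi> ?y = 0"
    using even_dihedral_artin_lift[of integer_group 1 0 p m] assms(1) by auto
  show ?thesis
  \<comment> \<open>The exponents \<open>of_bool\<close> express \<open>x^p = z^1\<close> and
    \<open>y^0 = z^0\<close>.\<close>
  proof (rule PCL_dihedral_artin_eq_0[where n = n and z = "?x [^]\<^bsub>?G\<^esub> p" and t = "of_bool" and \<rho> = \<rho> and \<phi> = \<phi>])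
    show "gen_xy m i [^]\<^bsub>?G\<^esub> n i = (?x [^]\<^bsub>?G\<^esub> p) [^]\<^bsub>?G\<^esub> (of_bool i :: int)" for i
      using xy by (simp add: gen_xy_def n_def int_pow_int)
    show "\<phi> (?x [^]\<^bsub>?G\<^esub> p) \<noteq> 0"
      using hom_nat_pow[OF \<phi>(1) xy(1) is_group group_integer_group] \<phi>(2) assms(2) by simp
    show "\<rho> (gen_xy m i) = translation i 1" for i
      using \<rho> by (simp add: gen_xy_def)
  qed (use aX bX z xy \<rho>(1) \<phi>(1) in \<open>auto simp: a_def b_def\<close>)
qed

theorem proposition6p3:
  fixes m :: nat
  assumes "m \<ge> 3"
  shows "\<exists>c. \<forall>n. PCL (dihedral_artin m) (free_product_gens m) n = c"
proof (cases "odd m")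
  case True
  then show ?thesis by (simp add: PCL_odd_dihedral_artin)
next
  case False
  then obtain p where "m = 2 * p" by (auto elim: evenE)
  then show ?thesis using assms PCL_even_dihedral_artin[of m p] by auto
qed

end
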